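(* Let $p,q,r\in(1,\infty]$ and assume that there is a constant $C>0$ such that the Fourier multipliers $T_m$ satisfy $$\|T_m f\|_{L^q(\mathbb{R}^d)}\le C\,\|m\|_{L^{r,\infty}(\mathbb{R}^d)}\,\|f\|_{L^p(\mathbb{R}^d)}\qquad\text{for every } f,m\in\mathcal{S}(\mathbb{R}^d).$$ Then $$\frac1q\le\frac1r+\frac1p .$$
   Context: The Fourier transform is $\mathcal{F}f(\omega)=\hat f(\omega)=\int_{\mathbb{R}^d}e^{-2\pi i t\cdot\omega}f(t)\,dt$. The Fourier multiplier with multiplier $m$ is $T_mf=\mathcal{F}^{-1}(m\,\mathcal{F}f)$, $f\in\mathcal{S}(\mathbb{R}^d)$. For $r\in[1,\infty)$ the weak $L^r$ space $L^{r,\infty}(\mathbb{R}^d)$ has quasi-norm $\|f\|_{L^{r,\infty}}=\sup_{\alpha>0}\alpha\,\mu(\{t\in\mathbb{R}^d:|f(t)|>\alpha\})^{1/r}$, with $\mu$ Lebesgue measure; $L^{\infty,\infty}(\mathbb{R}^d):=L^\infty(\mathbb{R}^d)$. By convention $1/\infty=0$. *)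

theory Defs
  imports "HOL-Probability.Probability"
begin

definition partial_deriv :: "'n \<Rightarrow> (real ^ 'n \<Rightarrow> complex) \<Rightarrow> real ^ 'n \<Rightarrow> complex" where
  "partial_deriv i f x = vector_derivative (\<lambda>s. f (x + s *\<^sub>R axis i 1)) (at 0)"

text \<open>Higher partial derivatives are indexed by the list of the directions in which one
  differentiates; for a smooth function the order of the list is irrelevant.\<close>

definition iter_partial :: "'n list \<Rightarrow> (real ^ 'n \<Rightarrow> complex) \<Rightarrow> real ^ 'n \<Rightarrow> complex" where
  "iter_partial is f = foldr partial_deriv is f"

text \<open>The Schwartz space: the first conjunct says that \<open>f\<close> is of class \<open>C\<^sup>\<infinity>\<close>, the second that
  \<open>x\<^sup>\<alpha> \<partial>\<^sup>\<beta> f\<close> is bounded for all multi-indices.\<close>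

definition schwartz :: "(real ^ 'n \<Rightarrow> complex) set" where
  "schwartz = {f.
     (\<forall>is x. iter_partial is f differentiable (at x)) \<and>
     (\<forall>(\<alpha> :: 'n \<Rightarrow> nat) is. bounded (range (\<lambda>x. (\<Prod>i\<in>UNIV. (x $ i) ^ \<alpha> i) *\<^sub>R iter_partial is f x)))}"

definition fourier :: "(real ^ 'n \<Rightarrow> complex) \<Rightarrow> real ^ 'n \<Rightarrow> complex" where
  "fourier f \<omega> = (LINT t|lborel. exp (- (2 * of_real pi * \<i> * of_real (t \<bullet> \<omega>))) * f t)"

text \<open>The inverse transform is given by its integral formula; on the Schwartz space this is
  the inverse of \<^const>\<open>fourier\<close>.\<close>

definition inv_fourier :: "(real ^ 'n \<Rightarrow> complex) \<Rightarrow> real ^ 'n \<Rightarrow> complex" where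
  "inv_fourier g t = (LINT \<omega>|lborel. exp (2 * of_real pi * \<i> * of_real (t \<bullet> \<omega>)) * g \<omega>)"

definition fourier_multiplier ::
  "(real ^ 'n \<Rightarrow> complex) \<Rightarrow> (real ^ 'n \<Rightarrow> complex) \<Rightarrow> real ^ 'n \<Rightarrow> complex" where
  "fourier_multiplier m f = inv_fourier (\<lambda>\<omega>. m \<omega> * fourier f \<omega>)"

text \<open>Real powers of extended nonnegative reals, intended for exponents \<open>a > 0\<close> only.\<close>

definition ennreal_powr :: "ennreal \<Rightarrow> real \<Rightarrow> ennreal" where
  "ennreal_powr x a = (if x = \<infinity> then \<infinity> else ennreal (enn2real x powr a))"

definition Lp_norm :: "ennreal \<Rightarrow> (real ^ 'n \<Rightarrow> complex) \<Rightarrow> ennreal" where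
  "Lp_norm p f =
     (if p = \<infinity> then esssup lborel (\<lambda>t. ennreal (norm (f t)))
      else ennreal_powr (\<integral>\<^sup>+ t. ennreal (norm (f t) powr enn2real p) \<partial>lborel) (1 / enn2real p))"

definition weak_Lp_norm :: "ennreal \<Rightarrow> (real ^ 'n \<Rightarrow> complex) \<Rightarrow> ennreal" where
  "weak_Lp_norm r f =
     (if r = \<infinity> then Lp_norm \<infinity> f
      else (SUP \<alpha>\<in>{0<..}.
              ennreal \<alpha> * ennreal_powr (emeasure lborel {t. norm (f t) > \<alpha>}) (1 / enn2real r)))"

end

(* Test the inequality on Gaussians: m x = exp (-pi |x|^2) is kept fixed, and
   f x = exp (-pi a |x|^2) with a tending to 0.  Then T_m f is (1 + a)^(-n/2) times the Gaussian
   of parameter a / (1 + a), so the left-hand side is of order a^(-n/(2q)) and the right-hand side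
   of order a^(-n/(2p)).  This forces 1/q <= 1/p, which is more than is claimed. *)
theory Submission
  imports Defs
begin

section \<open>Fourier integrals of Gaussians\<close>

text \<open>Up to scaling this is the characteristic function of the standard normal distribution,
  exp (-t^2/2). The substitution of \<open>c * x\<close> for \<open>x\<close> turns the normal
  density into the Gaussian with parameter \<open>a\<close>.\<close>

lemma fourier_gaussian_real:
  fixes a w :: real
  assumes a: "a > 0"
  shows "has_bochner_integral lborel
    (\<lambda>x::real. exp (- (2 * of_real pi * \<i> * of_real (x * w))) * complex_of_real (exp (- (pi * a * x\<^sup>2))))
    (complex_of_real (a powr (-1/2) * exp (- (pi * w\<^sup>2 / a))))"
proof -
  \<comment> \<open>Chosen so that (c x)^2 / 2 = pi a x^2.\<close>
  define c where "c = sqrt (2 * pi * a)"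
  have c: "c > 0" "c\<^sup>2 = 2 * pi * a" using a by (auto simp: c_def)
  let ?g = "\<lambda>t x. std_normal_density x *\<^sub>R iexp (t * x)"
  have int: "integrable lborel (?g t)" for t
    by (rule Bochner_Integration.integrable_bound[OF integrable_normal_density[of 1 0]]) auto
  have val: "(LINT x|lborel. ?g t x) = complex_of_real (exp (- (t\<^sup>2) / 2))" for t
    using fun_cong[OF char_std_normal_distribution, of t]
    by (simp add: char_def integral_density)
  \<comment> \<open>The argument of the characteristic function for which
    \<open>?t * (c * x)\<close> is the phase -2 pi x w.\<close>
  let ?t = "- (2 * pi * w / c)"
  have "has_bochner_integral lborel (?g ?t) (complex_of_real (exp (- (?t\<^sup>2) / 2)))"
    using int[of ?t] val[of ?t] by (simp add: has_bochner_integral_iff)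
  then have "has_bochner_integral lborel (\<lambda>x. ?g ?t (0 + c * x))
      (complex_of_real (exp (- (?t\<^sup>2) / 2)) /\<^sub>R \<bar>c\<bar>)"
    using c by (subst (asm) lborel_has_bochner_integral_real_affine_iff[where c=c and t=0]) auto
  \<comment> \<open>The factor sqrt (2 pi) removes the normalisation of the normal density; together
    with the Jacobian 1/c it leaves a^(-1/2).\<close>
  then have "has_bochner_integral lborel (\<lambda>x. sqrt (2 * pi) *\<^sub>R ?g ?t (0 + c * x))
      (sqrt (2 * pi) *\<^sub>R (complex_of_real (exp (- (?t\<^sup>2) / 2)) /\<^sub>R \<bar>c\<bar>))"
    by (rule has_bochner_integral_scaleR_right)
  moreover have "(\<lambda>x. sqrt (2 * pi) *\<^sub>R ?g ?t (0 + c * x)) =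
      (\<lambda>x::real. exp (- (2 * of_real pi * \<i> * of_real (x * w))) * complex_of_real (exp (- (pi * a * x\<^sup>2))))"
    using c by (auto simp: std_normal_density_def power_mult_distrib scaleR_conv_of_real fun_eq_iff mult_ac)
  moreover have "- (?t\<^sup>2) / 2 = - (pi * w\<^sup>2 / a)"
    using a by (simp add: power_divide power_mult_distrib c(2)) (simp add: field_simps power2_eq_square)
  moreover have "sqrt (2 * pi) * inverse \<bar>c\<bar> = a powr (-1/2)"
    using a by (simp add: c_def real_sqrt_mult powr_minus powr_half_sqrt inverse_eq_divide)
  then have "sqrt (2 * pi) *\<^sub>R (complex_of_real y /\<^sub>R \<bar>c\<bar>) = complex_of_real (a powr (-1/2) * y)" for y
    by (metis scaleR_scaleR scaleR_conv_of_real of_real_mult)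
  ultimately show ?thesis by simp
qed

text \<open>Fubini for a product of functions of one coordinate each: Lebesgue measure on a
  Euclidean space is the image of the product of one-dimensional Lebesgue measures under the map
  from coordinates to vectors.\<close>

lemma has_bochner_integral_lborel_prod:
  fixes f :: "'a::euclidean_space \<Rightarrow> real \<Rightarrow> 'b::{real_normed_field,banach,second_countable_topology}"
  assumes f: "\<And>b. b \<in> Basis \<Longrightarrow> has_bochner_integral lborel (f b) (I b)"
  shows "has_bochner_integral lborel (\<lambda>x::'a. \<Prod>b\<in>Basis. f b (x \<bullet> b)) (\<Prod>b\<in>Basis. I b)"
proof -
  interpret product_sigma_finite "\<lambda>b::'a. lborel :: real measure" ..
  have int: "integrable lborel (f b)" "integral\<^sup>L lborel (f b) = I b" if "b \<in> Basis" for b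
    using f[OF that] by (auto simp: has_bochner_integral_iff)
  have [measurable]: "f b \<in> borel_measurable borel" if "b \<in> Basis" for b
    using int(1)[OF that] by auto
  have m [measurable]: "(\<lambda>x::'a. \<Prod>b\<in>Basis. f b (x \<bullet> b)) \<in> borel_measurable borel"
    by measurable
  have "has_bochner_integral (\<Pi>\<^sub>M b\<in>Basis. lborel) (\<lambda>x. \<Prod>b\<in>Basis. f b (x b)) (\<Prod>b\<in>Basis. I b)"
    using product_integrable_prod[of Basis f] product_integral_prod[of Basis f] int
    by (simp add: has_bochner_integral_iff)
  then have "has_bochner_integral (\<Pi>\<^sub>M b\<in>Basis. lborel)
      (\<lambda>x. \<Prod>b\<in>Basis. f b ((\<Sum>c\<in>Basis. x c *\<^sub>R c :: 'a) \<bullet> b)) (\<Prod>b\<in>Basis. I b)"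
    by (simp cong: prod.cong)
  then show ?thesis
    by (subst lborel_eq) (auto simp: has_bochner_integral_iff integrable_distr_eq integral_distr)
qed

text \<open>Both x . w and x . x are sums over the coordinates, so the integrand is a product of
  one-dimensional integrands and the exponents -1/2 add up to minus half the dimension.\<close>

lemma fourier_gaussian:
  fixes w :: "'a::euclidean_space"
  assumes a: "a > 0"
  shows "has_bochner_integral lborel
    (\<lambda>x::'a. exp (- (2 * of_real pi * \<i> * of_real (x \<bullet> w))) * complex_of_real (exp (- (pi * a * (x \<bullet> x)))))
    (complex_of_real (a powr (- real DIM('a) / 2) * exp (- (pi * (w \<bullet> w) / a))))"
proof -
  have "has_bochner_integral lborel (\<lambda>x::'a. \<Prod>b\<in>Basis.
      exp (- (2 * of_real pi * \<i> * of_real ((x \<bullet> b) * (w \<bullet> b)))) * complex_of_real (exp (- (pi * a * (x \<bullet> b)\<^sup>2))))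
    (\<Prod>b\<in>Basis. complex_of_real (a powr (-1/2) * exp (- (pi * (w \<bullet> b)\<^sup>2 / a))))"
    by (rule has_bochner_integral_lborel_prod) (rule fourier_gaussian_real[OF a])
  moreover have "(\<Prod>b\<in>Basis.
      exp (- (2 * of_real pi * \<i> * of_real ((x \<bullet> b) * (w \<bullet> b)))) * complex_of_real (exp (- (pi * a * (x \<bullet> b)\<^sup>2))))
    = exp (- (2 * of_real pi * \<i> * of_real (x \<bullet> w))) * complex_of_real (exp (- (pi * a * (x \<bullet> x))))" for x :: 'a
    by (simp add: prod.distrib euclidean_inner[of x w] euclidean_inner[of x x] sum_distrib_left sum_negf power2_eq_square
       flip: exp_sum of_real_prod)
  moreover have "(\<Prod>b\<in>Basis. complex_of_real (a powr (-1/2) * exp (- (pi * (w \<bullet> b)\<^sup>2 / a)))) =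
     complex_of_real (a powr (- real DIM('a) / 2) * exp (- (pi * (w \<bullet> w) / a)))"
    using a by (simp add: prod.distrib euclidean_inner[of w w] sum_distrib_left sum_negf power2_eq_square powr_realpow[symmetric] powr_powr sum_divide_distrib
       flip: exp_sum of_real_prod of_real_mult of_real_power powr_realpow)
  ultimately show ?thesis by simp
qed

text \<open>This is the Fourier integral at frequency 0, read as an integral of a nonnegative
  function.\<close>

lemma nn_integral_gaussian:
  assumes a: "a > 0"
  shows "(\<integral>\<^sup>+x. ennreal (exp (- (pi * a * (x \<bullet> (x::'a::euclidean_space))))) \<partial>lborel)
    = ennreal (a powr (- real DIM('a) / 2))"
proof -
  have "has_bochner_integral lborel (\<lambda>x::'a. complex_of_real (exp (- (pi * a * (x \<bullet> x)))))
    (complex_of_real (a powr (- real DIM('a) / 2)))"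
    using fourier_gaussian[OF a, of "0::'a"] by simp
  then have "has_bochner_integral lborel (\<lambda>x::'a. exp (- (pi * a * (x \<bullet> x)))) (a powr (- real DIM('a) / 2))"
    by (simp add: has_bochner_integral_iff complex_of_real_integrable_eq)
  then show ?thesis
    by (simp add: has_bochner_integral_iff nn_integral_eq_integral)
qed

section \<open>Gaussians as Schwartz functions\<close>

text \<open>The factor pi makes \<open>gauss 1\<close> its own Fourier transform.\<close>

definition gauss :: "real \<Rightarrow> 'a::real_inner \<Rightarrow> complex" where
  "gauss a x = complex_of_real (exp (- (pi * a * (x \<bullet> x))))"

lemma norm_gauss: "norm (gauss a x) = exp (- (pi * a * (x \<bullet> x)))"
  by (simp add: gauss_def)

lemma borel_measurable_gauss [measurable]:
  "(gauss a :: 'a::euclidean_space \<Rightarrow> complex) \<in> borel_measurable borel"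
  unfolding gauss_def[abs_def] by measurable

text \<open>Induction on the construction of the polynomial, with the product rule for products. The
  derivative is taken along a line at 0 to match the form of \<open>partial_deriv\<close>.\<close>

lemma real_polynomial_function_directional_derivative:
  assumes "real_polynomial_function P"
  shows "\<exists>Q. real_polynomial_function Q \<and>
    (\<forall>x. ((\<lambda>s. P (x + s *\<^sub>R v)) has_real_derivative Q x) (at 0))"
  using assms
proof induction
  case (linear f)
  then interpret bounded_linear f .
  have "((\<lambda>s. f (x + s *\<^sub>R v)) has_real_derivative f v) (at 0)" for x
    by (auto simp: add scaleR intro!: derivative_eq_intros)
  then show ?case by (intro exI[of _ "\<lambda>_. f v"]) auto
next
  case (const c)
  show ?case by (intro exI[of _ "\<lambda>_. 0"]) auto
next
  case (add f g)
  then obtain F G where FG: "real_polynomial_function F" "real_polynomial_function G"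
    "\<And>x. ((\<lambda>s. f (x + s *\<^sub>R v)) has_real_derivative F x) (at 0)"
    "\<And>x. ((\<lambda>s. g (x + s *\<^sub>R v)) has_real_derivative G x) (at 0)" by blast
  then show ?case
    by (intro exI[of _ "\<lambda>x. F x + G x"]) (auto intro!: DERIV_add)
next
  case (mult f g)
  then obtain F G where FG: "real_polynomial_function F" "real_polynomial_function G"
    "\<And>x. ((\<lambda>s. f (x + s *\<^sub>R v)) has_real_derivative F x) (at 0)"
    "\<And>x. ((\<lambda>s. g (x + s *\<^sub>R v)) has_real_derivative G x) (at 0)" by blast
  then have "((\<lambda>s. f (x + s *\<^sub>R v) * g (x + s *\<^sub>R v)) has_real_derivative F x * g x + G x * f x) (at 0)" for x
    using DERIV_mult[OF FG(3)[of x] FG(4)[of x]] by simp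
  then show ?case
    using FG(1,2) mult.hyps by (intro exI[of _ "\<lambda>x. F x * g x + G x * f x"]) auto
qed

text \<open>Induction with \<open>e\<close> left arbitrary: for a product, each factor is bounded
  with \<open>e / 2\<close> and the two exponentials multiply to the one with
  \<open>e\<close>.\<close>

lemma real_polynomial_function_le_exp:
  fixes P :: "'a::real_inner \<Rightarrow> real"
  assumes "real_polynomial_function P" "e > 0"
  shows "\<exists>C. \<forall>x. \<bar>P x\<bar> \<le> C * exp (e * (x \<bullet> x))"
  using assms
proof (induction arbitrary: e)
  case (linear f)
  obtain K where K: "\<And>x. norm (f x) \<le> norm x * K" "K > 0"
    using bounded_linear.pos_bounded[OF linear(1)] by blast
  have "\<bar>f x\<bar> \<le> (K * (1 + 1 / e)) * exp (e * (x \<bullet> x))" for x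
  proof -
    \<comment> \<open>Linear growth is first dominated by 1 + |x|^2. The factor 1 + 1/e then
      replaces |x|^2 by e |x|^2, so that 1 + y \<le> exp y applies.\<close>
    have "0 \<le> (norm x - 1)\<^sup>2" by simp
    then have "norm x \<le> 1 + x \<bullet> x"
      by (simp add: power2_diff power2_norm_eq_inner) (use inner_ge_zero[of x] in linarith)
    also have "\<dots> \<le> (1 + 1 / e) * (1 + e * (x \<bullet> x))"
      using linear(2) by (simp add: field_simps)
    also have "\<dots> \<le> (1 + 1 / e) * exp (e * (x \<bullet> x))"
      using linear(2) by (intro mult_left_mono exp_ge_add_one_self) auto
    finally have "norm x * K \<le> (1 + 1 / e) * exp (e * (x \<bullet> x)) * K"
      using K(2) by (intro mult_right_mono) auto
    then show ?thesis using K(1)[of x] by (simp add: mult_ac)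
  qed
  then show ?case by blast
next
  case (const c)
  have "\<bar>c\<bar> \<le> \<bar>c\<bar> * exp (e * (x \<bullet> x))" for x :: 'a
    using const by (simp add: mult_le_cancel_left1)
  then show ?case by blast
next
  case (add f g)
  obtain A B where "\<And>x. \<bar>f x\<bar> \<le> A * exp (e * (x \<bullet> x))" "\<And>x. \<bar>g x\<bar> \<le> B * exp (e * (x \<bullet> x))"
    using add by meson
  then have "\<bar>f x + g x\<bar> \<le> (A + B) * exp (e * (x \<bullet> x))" for x
    by (smt (verit) distrib_right)
  then show ?case by blast
next
  case (mult f g)
  obtain A B where AB: "\<And>x. \<bar>f x\<bar> \<le> A * exp (e / 2 * (x \<bullet> x))" "\<And>x. \<bar>g x\<bar> \<le> B * exp (e / 2 * (x \<bullet> x))"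
    using mult by (meson half_gt_zero)
  have "\<bar>f x * g x\<bar> \<le> (A * B) * exp (e * (x \<bullet> x))" for x
  proof -
    have "\<bar>f x\<bar> * \<bar>g x\<bar> \<le> (A * exp (e / 2 * (x \<bullet> x))) * (B * exp (e / 2 * (x \<bullet> x)))"
      using AB[of x] by (intro mult_mono) (auto intro: order_trans[OF abs_ge_zero])
    also have "\<dots> = (A * B) * exp (e * (x \<bullet> x))"
      by (simp add: mult_ac flip: exp_add)
    finally show ?thesis by (simp add: abs_mult)
  qed
  then show ?case by blast
qed

text \<open>Products of a polynomial with the fixed Gaussian are closed under partial derivatives,
  because differentiating the Gaussian only brings down a linear factor.\<close>

lemma iter_partial_gauss:
  "\<exists>P. real_polynomial_function P \<and>
    (\<forall>x. iter_partial is (gauss a) x = complex_of_real (P x * exp (- (pi * a * (x \<bullet> x)))))"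
proof (induction "is")
  case Nil
  show ?case
    by (intro exI[of _ "\<lambda>_. 1"]) (auto simp: iter_partial_def gauss_def)
next
  case (Cons i "is")
  then obtain P where P: "real_polynomial_function P"
    "iter_partial is (gauss a) = (\<lambda>x. complex_of_real (P x * exp (- (pi * a * (x \<bullet> x)))))" by auto
  let ?v = "axis i 1 :: real ^ 'a"
  obtain Q where Q: "real_polynomial_function Q"
    "\<And>x. ((\<lambda>s. P (x + s *\<^sub>R ?v)) has_real_derivative Q x) (at 0)"
    using real_polynomial_function_directional_derivative[OF P(1)] by blast
  \<comment> \<open>The product rule: the exponent -pi a |x|^2 has derivative -2 pi a (x . v) in the
    direction v.\<close>
  let ?R = "\<lambda>x. Q x + (- 2 * pi * a) * (x \<bullet> ?v) * P x"
  have "((\<lambda>s. exp (- (pi * a * ((x + s *\<^sub>R ?v) \<bullet> (x + s *\<^sub>R ?v))))) has_real_derivative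
      (- 2 * pi * a) * (x \<bullet> ?v) * exp (- (pi * a * (x \<bullet> x)))) (at 0)" for x
    unfolding inner_add_left inner_add_right inner_scaleR_left inner_scaleR_right
    by (auto intro!: derivative_eq_intros simp: inner_commute algebra_simps)
  from DERIV_mult[OF Q(2) this]
  have "((\<lambda>s. P (x + s *\<^sub>R ?v) * exp (- (pi * a * ((x + s *\<^sub>R ?v) \<bullet> (x + s *\<^sub>R ?v))))) has_real_derivative
      ?R x * exp (- (pi * a * (x \<bullet> x)))) (at 0)" for x
    by (simp add: algebra_simps)
  then have "((\<lambda>s. complex_of_real (P (x + s *\<^sub>R ?v) * exp (- (pi * a * ((x + s *\<^sub>R ?v) \<bullet> (x + s *\<^sub>R ?v)))))) 
      has_vector_derivative complex_of_real (?R x * exp (- (pi * a * (x \<bullet> x))))) (at 0)" for x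
    by (intro has_vector_derivative_of_real) (auto simp: has_real_derivative_iff_has_vector_derivative)
  then have "iter_partial (i # is) (gauss a) x = complex_of_real (?R x * exp (- (pi * a * (x \<bullet> x))))" for x
    by (simp only: iter_partial_def foldr_Cons o_apply partial_deriv_def
      P(2)[unfolded iter_partial_def] vector_derivative_at)
  moreover have "real_polynomial_function ?R"
    using P(1) Q(1) by (intro real_polynomial_function.intros(2-4) real_polynomial_function.intros(1)[OF bounded_linear_inner_left])
  ultimately show ?case by blast
qed

text \<open>Every derivative is a polynomial times the Gaussian. This is differentiable, and the
  decay of the Gaussian beats any polynomial weight.\<close>

lemma gauss_schwartz:
  assumes a: "a > 0"
  shows "(gauss a :: real ^ 'n \<Rightarrow> complex) \<in> schwartz"
  unfolding schwartz_def mem_Collect_eq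
proof (intro conjI allI)
  fix "is" :: "'n list" and x :: "real ^ 'n"
  obtain P where P: "real_polynomial_function P"
    "iter_partial is (gauss a) = (\<lambda>x. complex_of_real (P x * exp (- (pi * a * (x \<bullet> x)))))"
    using iter_partial_gauss[of "is" a] by auto
  have "((\<lambda>x. exp (- (pi * a * (x \<bullet> x)))) has_derivative
      (\<lambda>h. exp (- (pi * a * (x \<bullet> x))) * - (pi * a * (x \<bullet> h + h \<bullet> x)))) (at x)"
    by (auto intro!: derivative_eq_intros simp: algebra_simps)
  then have "(\<lambda>x. exp (- (pi * a * (x \<bullet> x)))) differentiable (at x)"
    unfolding differentiable_def by blast
  then have "(\<lambda>x. P x * exp (- (pi * a * (x \<bullet> x)))) differentiable (at x)"
    by (intro differentiable_mult differentiable_at_real_polynomial_function[OF P(1)])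
  then show "iter_partial is (gauss a) differentiable (at x)"
    unfolding P(2) differentiable_def using has_derivative_of_real by blast
next
  fix \<alpha> :: "'n \<Rightarrow> nat" and "is" :: "'n list"
  obtain P where P: "real_polynomial_function P"
    "iter_partial is (gauss a) = (\<lambda>x. complex_of_real (P x * exp (- (pi * a * (x \<bullet> x)))))"
    using iter_partial_gauss[of "is" a] by auto
  have "real_polynomial_function (\<lambda>x::real ^ 'n. (\<Prod>i\<in>UNIV. (x $ i) ^ \<alpha> i) * P x)"
    by (intro real_polynomial_function.intros(4)[OF _ P(1)] real_polynomial_function_prod
      real_polynomial_function_power real_polynomial_function.intros(1)[OF bounded_linear_vec_nth]) auto
  \<comment> \<open>With e = pi a the growth allowed for the polynomial is exactly cancelled by the
    Gaussian factor.\<close>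
  from real_polynomial_function_le_exp[OF this, of "pi * a"] a
  obtain C where C: "\<And>x::real ^ 'n. \<bar>(\<Prod>i\<in>UNIV. (x $ i) ^ \<alpha> i) * P x\<bar> \<le> C * exp (pi * a * (x \<bullet> x))"
    by auto
  have "norm ((\<Prod>i\<in>UNIV. (x $ i) ^ \<alpha> i) *\<^sub>R iter_partial is (gauss a) x) \<le> C" for x :: "real ^ 'n"
  proof -
    have "norm ((\<Prod>i\<in>UNIV. (x $ i) ^ \<alpha> i) *\<^sub>R iter_partial is (gauss a) x) =
      \<bar>(\<Prod>i\<in>UNIV. (x $ i) ^ \<alpha> i) * P x\<bar> * exp (- (pi * a * (x \<bullet> x)))"
      by (simp add: P(2) norm_mult abs_mult)
    also have "\<dots> \<le> C * exp (pi * a * (x \<bullet> x)) * exp (- (pi * a * (x \<bullet> x)))"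
      by (intro mult_right_mono C) auto
    also have "\<dots> = C" by (simp add: mult.assoc flip: exp_add)
    finally show ?thesis .
  qed
  then show "bounded (range (\<lambda>x. (\<Prod>i\<in>UNIV. (x $ i) ^ \<alpha> i) *\<^sub>R iter_partial is (gauss a) x))"
    by (auto simp: bounded_iff)
qed

section \<open>Fourier multipliers applied to Gaussians\<close>

lemma fourier_gauss:
  assumes a: "a > 0"
  shows "fourier (gauss a) (w :: real ^ 'n) = of_real (a powr (- real CARD('n) / 2)) * gauss (1 / a) w"
  using has_bochner_integral_integral_eq[OF fourier_gaussian[OF a, of w]]
  by (simp add: fourier_def gauss_def)

text \<open>The inverse transform at \<open>t\<close> is the transform at \<open>- t\<close>, and
  Gaussians are even.\<close>

lemma inv_fourier_gauss:
  assumes a: "a > 0"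
  shows "inv_fourier (\<lambda>w. c * gauss a w) (t :: real ^ 'n) =
    c * (of_real (a powr (- real CARD('n) / 2)) * gauss (1 / a) t)"
proof -
  have "inv_fourier (\<lambda>w. c * gauss a w) t = c * fourier (gauss a) (- t)"
    by (simp add: inv_fourier_def fourier_def inner_commute mult.left_commute[of _ c])
  also have "\<dots> = c * (of_real (a powr (- real CARD('n) / 2)) * gauss (1 / a) t)"
    by (simp add: fourier_gauss[OF a]) (simp add: gauss_def)
  finally show ?thesis .
qed

text \<open>On the Fourier side the parameters 1 and 1/a add to (1 + a)/a, and transforming back
  inverts this parameter. The powers of \<open>a\<close> in the two constants cancel.\<close>

lemma fourier_multiplier_gauss:
  fixes x :: "real ^ 'n"
  assumes a: "a > 0"
  shows "fourier_multiplier (gauss 1) (gauss a) x =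
    of_real ((1 + a) powr (- real CARD('n) / 2)) * gauss (a / (1 + a)) x"
proof -
  let ?d = "- real CARD('n) / 2"
  have *: "gauss 1 w * fourier (gauss a) w = of_real (a powr ?d) * gauss ((1 + a) / a) w"
    for w :: "real ^ 'n"
    using a by (simp add: fourier_gauss gauss_def field_simps flip: exp_add of_real_mult)
  have "a powr ?d * ((1 + a) / a) powr ?d = (1 + a) powr ?d"
    using a by (simp add: powr_mult[symmetric])
  then show ?thesis
    using a unfolding fourier_multiplier_def *
    by (subst inv_fourier_gauss) (auto simp flip: of_real_mult mult.assoc)
qed

section \<open>Strong and weak norms of Gaussians\<close>

text \<open>With s the real value of \<open>p\<close>, the s-th power of the modulus is c^s times
  the Gaussian with parameter b s, whose integral is known.\<close>

lemma Lp_norm_gauss: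
  assumes "b > 0" "c > 0" "p \<noteq> \<infinity>" "p > 0"
  shows "Lp_norm p (\<lambda>x :: real ^ 'n. of_real c * gauss b x) =
    ennreal (c * (b * enn2real p) powr (- real CARD('n) / 2 / enn2real p))"
proof -
  define s where "s = enn2real p"
  have s: "s > 0"
    using assms(3,4) by (cases p) (auto simp: s_def)
  let ?d = "- real CARD('n) / 2"
  have "(\<integral>\<^sup>+ t. ennreal (norm (of_real c * gauss b (t :: real ^ 'n)) powr s) \<partial>lborel)
      = (\<integral>\<^sup>+ t. ennreal (c powr s) * ennreal (exp (- (pi * (b * s) * (t \<bullet> (t :: real ^ 'n))))) \<partial>lborel)"
    using assms(1,2) s
    by (intro nn_integral_cong)
       (auto simp: norm_mult norm_gauss powr_mult exp_powr_real mult_ac simp flip: ennreal_mult)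
  also have "\<dots> = ennreal (c powr s * (b * s) powr ?d)"
    using s assms(1,2) by (simp add: nn_integral_cmult nn_integral_gaussian ennreal_mult)
  finally have "Lp_norm p (\<lambda>x :: real ^ 'n. of_real c * gauss b x) =
      ennreal ((c powr s * (b * s) powr ?d) powr (1 / s))"
    using assms(3) by (simp add: Lp_norm_def ennreal_powr_def s_def[symmetric])
  also have "(c powr s * (b * s) powr ?d) powr (1 / s) = c * (b * s) powr (?d / s)"
    using s assms(1,2) by (simp add: powr_mult powr_powr)
  finally show ?thesis by (simp add: s_def)
qed

text \<open>This treats finite and infinite exponents uniformly: for \<open>p = \<infinity>\<close>
  the exponent \<open>enn2real (1 / p)\<close> is 0 and the bound is the constant 1.\<close>

lemma Lp_norm_gauss_le:
  assumes "p > 0"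
  obtains K where "K > 0"
    "\<And>b. b > 0 \<Longrightarrow> Lp_norm p (gauss b :: real ^ 'n \<Rightarrow> complex) \<le>
      ennreal (K * b powr (- real CARD('n) / 2 * enn2real (1 / p)))"
proof (cases "p = \<infinity>")
  case True
  have "Lp_norm p (gauss b :: real ^ 'n \<Rightarrow> complex) \<le> ennreal (1 * b powr (- real CARD('n) / 2 * enn2real (1 / p)))"
    if "b > 0" for b
    using that True by (auto simp: Lp_norm_def norm_gauss intro!: esssup_I)
  then show ?thesis by (intro that[of 1]) auto
next
  case False
  then have s: "enn2real p > 0" using assms by (cases p) auto
  have inv: "enn2real (1 / p) = 1 / enn2real p"
    using assms False by (cases p) (auto simp: divide_ennreal simp flip: ennreal_1)
  show ?thesis
  proof (rule that[of "enn2real p powr (- real CARD('n) / 2 / enn2real p)"])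
    fix b :: real assume "b > 0"
    then show "Lp_norm p (gauss b :: real ^ 'n \<Rightarrow> complex) \<le>
      ennreal (enn2real p powr (- real CARD('n) / 2 / enn2real p) * b powr (- real CARD('n) / 2 * enn2real (1 / p)))"
      using Lp_norm_gauss[of b 1 p, where ?'n='n] assms False s
      by (simp add: powr_mult inv mult.commute)
  qed (use s in auto)
qed

text \<open>Chebyshev's inequality, level by level. It serves to show that the weak norm of the
  fixed multiplier is finite.\<close>

lemma weak_Lp_norm_le_Lp_norm:
  fixes f :: "real ^ 'n \<Rightarrow> complex"
  assumes [measurable]: "f \<in> borel_measurable borel" and "r > 0"
  shows "weak_Lp_norm r f \<le> Lp_norm r f"
proof (cases "r = \<infinity>")
  case False
  define s where "s = enn2real r"
  have s: "s > 0"
    using assms(2) False by (cases r) (auto simp: s_def)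
  let ?I = "\<integral>\<^sup>+ t. ennreal (norm (f t) powr s) \<partial>lborel"
  have "ennreal \<alpha> * ennreal_powr (emeasure lborel {t. norm (f t) > \<alpha>}) (1 / s) \<le> ennreal_powr ?I (1 / s)"
    if \<alpha>: "\<alpha> > 0" for \<alpha>
  proof (cases ?I)
    case (real i)
    \<comment> \<open>The superlevel set is rewritten in the form that Markov's inequality for |f|^s
      expects.\<close>
    have "emeasure lborel {t. norm (f t) > \<alpha>} \<le>
        emeasure lborel {t\<in>UNIV. 1 \<le> ennreal (\<alpha> powr - s) * ennreal (norm (f t) powr s)}"
    proof (rule emeasure_mono)
      show "{t. norm (f t) > \<alpha>} \<subseteq> {t\<in>UNIV. 1 \<le> ennreal (\<alpha> powr - s) * ennreal (norm (f t) powr s)}"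
      proof clarsimp
        fix t assume "\<alpha> < norm (f t)"
        then have "\<alpha> powr s \<le> norm (f t) powr s" using \<alpha> s by (intro powr_mono2) auto
        then show "1 \<le> ennreal (\<alpha> powr - s) * ennreal (norm (f t) powr s)"
          using \<alpha> by (simp add: powr_minus field_simps flip: ennreal_mult ennreal_1)
      qed
    qed measurable
    also have "\<dots> \<le> ennreal (\<alpha> powr - s) * (\<integral>\<^sup>+ t. ennreal (norm (f t) powr s) * indicator UNIV t \<partial>lborel)"
      by (rule nn_integral_Markov_inequality) auto
    also have "\<dots> = ennreal (\<alpha> powr - s * i)"
      using real by (simp add: ennreal_mult)
    \<comment> \<open>The superlevel set has finite measure, so the rest is arithmetic with real
      numbers.\<close>
    finally obtain e where e: "emeasure lborel {t. norm (f t) > \<alpha>} = ennreal e" "0 \<le> e" "e \<le> \<alpha> powr - s * i"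
      using real by (cases "emeasure lborel {t. norm (f t) > \<alpha>}") (auto simp: top_unique)
    have "\<alpha> * e powr (1 / s) \<le> \<alpha> * (\<alpha> powr - s * i) powr (1 / s)"
      using e \<alpha> s by (intro mult_left_mono powr_mono2) auto
    also have "\<dots> = i powr (1 / s)"
      using real \<alpha> s by (simp add: powr_mult powr_powr powr_neg_one)
    finally show ?thesis
      using real e \<alpha> by (simp add: ennreal_powr_def flip: ennreal_mult)
  qed (simp add: ennreal_powr_def)
  then show ?thesis
    using False by (auto simp: weak_Lp_norm_def Lp_norm_def s_def intro!: SUP_least)
qed (simp add: weak_Lp_norm_def)

section \<open>Comparison of both sides for small parameters\<close>

theorem proposition1p2:
  fixes p q r :: ennreal
  assumes "1 < p" and "1 < q" and "1 < r"
    and "\<exists>C::real. C > 0 \<and>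
      (\<forall>f \<in> schwartz. \<forall>m \<in> (schwartz :: (real ^ 'n \<Rightarrow> complex) set).
         Lp_norm q (fourier_multiplier m f) \<le> ennreal C * weak_Lp_norm r m * Lp_norm p f)"
  shows "1 / q \<le> 1 / r + 1 / p"
proof (rule ccontr)
  assume neg: "\<not> 1 / q \<le> 1 / r + 1 / p"
  have pos: "p > 0" "q > 0" "r > 0"
    using assms(1-3) by (auto intro: less_trans[OF zero_less_one])
  \<comment> \<open>Since 1/r is nonnegative, the negated conclusion gives 1/p < 1/q, and this gap
    yields the contradiction. It also makes 1/q positive, hence \<open>q\<close> finite.\<close>
  have less: "1 / p < 1 / q"
    using neg by (meson add_increasing linorder_not_le order_trans order_refl zero_le)
  then have q: "q \<noteq> \<infinity>" by auto
  define s where "s = enn2real q"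
  \<comment> \<open>The real value of 1/p, equal to 0 when \<open>p\<close> is infinite.\<close>
  define \<rho> where "\<rho> = enn2real (1 / p)"
  define d where "d = real CARD('n) / 2"
  have d: "d > 0" by (simp add: d_def)
  have s: "s > 0" using q pos(2) by (cases q) (auto simp: s_def)
  have invq: "1 / q = ennreal (1 / s)"
    using pos(2) q by (cases q) (auto simp: s_def divide_ennreal simp flip: ennreal_1)
  have \<rho>: "\<rho> < 1 / s"
    using less unfolding invq \<rho>_def
    by (cases "1 / p") (auto simp: ennreal_less_iff)
  obtain C :: real where C: "C > 0" and bound: "\<And>f m :: real ^ 'n \<Rightarrow> complex. f \<in> schwartz \<Longrightarrow> m \<in> schwartz \<Longrightarrow>
         Lp_norm q (fourier_multiplier m f) \<le> ennreal C * weak_Lp_norm r m * Lp_norm p f"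
    using assms(4) by blast
  obtain K where K: "K > 0" and Kp: "\<And>b. b > 0 \<Longrightarrow> Lp_norm p (gauss b :: real ^ 'n \<Rightarrow> complex) \<le>
      ennreal (K * b powr (- d * \<rho>))"
    using Lp_norm_gauss_le[OF pos(1), where ?'n='n] unfolding d_def \<rho>_def by (metis minus_divide_left)
  \<comment> \<open>The fixed multiplier contributes only a finite constant: its weak norm is at
    most its strong norm, and the power of \<open>b\<close> in the bound is 1 at b = 1.\<close>
  obtain W where W: "W > 0" and Wr: "weak_Lp_norm r (gauss 1 :: real ^ 'n \<Rightarrow> complex) \<le> ennreal W"
    using Lp_norm_gauss_le[OF pos(3), where ?'n='n] weak_Lp_norm_le_Lp_norm[OF _ pos(3), of "gauss 1 :: real ^ 'n \<Rightarrow> complex"]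
    by (metis borel_measurable_gauss mult_1_right order_trans powr_one_eq_one zero_less_one)
  \<comment> \<open>As \<open>a\<close> tends to 0, the left-hand side grows like a^(-d/s) and the
    right-hand side at most like a^(-d \<rho>); their quotient has order a^(-\<delta>).\<close>
  define \<delta> where "\<delta> = d * (1 / s - \<rho>)"
  have \<delta>: "\<delta> > 0" using d \<rho> by (simp add: \<delta>_def)
  define M where "M = C * W * K * 2 powr d * s powr (d / s)"
  have M: "M > 0" using C W K s by (simp add: M_def)
  have main: "a powr - \<delta> \<le> M" if a: "0 < a" "a \<le> 1" for a
  proof -
    have "ennreal ((1 + a) powr - d * (a / (1 + a) * s) powr (- d / s))
        = Lp_norm q (fourier_multiplier (gauss 1) (gauss a :: real ^ 'n \<Rightarrow> complex))"
      using a fourier_multiplier_gauss[OF a(1), where ?'n='n, abs_def]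
        Lp_norm_gauss[OF _ _ q pos(2), of "a / (1 + a)" "(1 + a) powr - d", where ?'n='n]
      by (simp add: d_def s_def)
    also have "\<dots> \<le> ennreal C * weak_Lp_norm r (gauss 1 :: real ^ 'n \<Rightarrow> complex) * Lp_norm p (gauss a :: real ^ 'n \<Rightarrow> complex)"
      using a by (intro bound gauss_schwartz) auto
    also have "\<dots> \<le> ennreal C * ennreal W * ennreal (K * a powr (- d * \<rho>))"
      by (intro mult_mono Wr Kp a) auto
    also have "\<dots> = ennreal (C * W * (K * a powr (- d * \<rho>)))"
      using C W K by (simp flip: ennreal_mult)
    finally have *: "(1 + a) powr - d * (a / (1 + a) * s) powr (- d / s) \<le> C * W * (K * a powr (- d * \<rho>))"
      using C W K by (subst (asm) ennreal_le_iff) auto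
    \<comment> \<open>For a in (0, 1] one has 1 + a \<le> 2 and a/(1 + a) \<le> a, and both
      exponents are negative, so each factor on the right is bounded from below.\<close>
    have "2 powr - d * (a * s) powr (- d / s) \<le> (1 + a) powr - d * (a / (1 + a) * s) powr (- d / s)"
      using a d s by (intro mult_mono powr_mono2') (auto simp: field_simps)
    with * have "2 powr - d * (a * s) powr (- d / s) \<le> C * W * (K * a powr (- d * \<rho>))"
      by simp
    \<comment> \<open>The new factor clears 2^(-d) and s^(-d/s) on the left and a^(-d \<rho>) on the
      right, which leaves a^(-\<delta>) and \<open>M\<close>.\<close>
    then have "(2 powr - d * (a * s) powr (- d / s)) * (2 powr d * s powr (d / s) * a powr (d * \<rho>))
       \<le> (C * W * (K * a powr (- d * \<rho>))) * (2 powr d * s powr (d / s) * a powr (d * \<rho>))"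
      by (rule mult_right_mono) simp
    also have "\<dots> = M"
      using a by (simp add: M_def powr_minus)
    also have "(2 powr - d * (a * s) powr (- d / s)) * (2 powr d * s powr (d / s) * a powr (d * \<rho>)) =
       a powr (- d / s) * a powr (d * \<rho>)"
      using a s by (simp add: powr_mult powr_minus) (simp add: field_simps)
    also have "\<dots> = a powr - \<delta>"
      by (simp add: \<delta>_def algebra_simps flip: powr_add)
    finally show ?thesis .
  qed
  \<comment> \<open>This value of \<open>a\<close> lies in (0, 1] and satisfies a^(-\<delta>) = M +
    1, which exceeds \<open>M\<close>.\<close>
  have "((M + 1) powr (- 1 / \<delta>)) powr - \<delta> \<le> M"
    using M \<delta> by (intro main) (auto intro!: powr_le_one_le simp: powr_minus powr_le1 ge_one_powr_ge_zero inverse_le_1_iff)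
  then show False
    using M \<delta> by (simp add: powr_powr)
qed

end
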